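(* Let $P,Q,P',Q'$ be integers and $M=\begin{pmatrix}P&P'\\Q&Q'\end{pmatrix}$. For each $x\in\Omega=[0,1]\setminus\mathbb Q$ the following are equivalent: (i) $P/Q$, $P'/Q'$ are successive convergents in $\mathrm{ECF}(x)$. (ii) $M\in\mathcal R_E$ and $0<|E_M(x)|<1$.
   Context: ECF expansion. Let $\mathbb N=\{1,2,\dots\}$, $D=\bigcup_{n\in 2\mathbb N-1}[\frac1{n+1},\frac1n)$. For $x\in\Omega$ put $e_D(x)=1$, $a_D(x)=[1/x]$, $T_D(x)=\{1/x\}$ if $x\notin D$, and $e_D(x)=-1$, $a_D(x)=1+[1/x]$, $T_D(x)=1-\{1/x\}$ if $x\in D$ (integer and fractional parts $[\cdot]$, $\{\cdot\}$). For $x\in\Omega$ set $t_n=T_D^n(x)$, $e_0=1$, and for $n\ge1$: $e_n=e_D(t_{n-1})$, $a_n=a_D(t_{n-1})$ (all $a_n$ are even positive integers). The convergents $p_n/q_n$ of $\mathrm{ECF}(x)$ are given by $p_{-1}=1$, $p_0=0$, $p_n=a_np_{n-1}+e_{n-1}p_{n-2}$, $q_{-1}=0$, $q_0=1$, $q_n=a_nq_{n-1}+e_{n-1}q_{n-2}$ for $n\ge1$. "$P/Q,P'/Q'$ are successive convergents in $\mathrm{ECF}(x)$" means that $P=p_{n-1}$, $Q=q_{n-1}$, $P'=p_n$, $Q'=q_n$ for some $n\ge1$. Let $I=\begin{pmatrix}1&0\\0&1\end{pmatrix}$, $J=\begin{pmatrix}0&1\\1&0\end{pmatrix}$. $\mathcal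 R_E$ is the set of matrices $M=\begin{pmatrix}P&P'\\Q&Q'\end{pmatrix}\in\mathrm{GL}_2(\mathbb Z)$ with $0\leqslant P\leqslant Q$, $1\leqslant P'\leqslant Q'$, $1\leqslant Q\leqslant Q'$, and $M\equiv I$ or $J \pmod 2$ (entrywise). For $x\notin\mathbb Q$, $E_M(x)=\dfrac{Q'x-P'}{-Qx+P}$. *)

theory Defs
  imports "HOL-Analysis.Analysis" "HOL-Number_Theory.Cong"
begin

section \<open>Continued fractions with even partial quotients\<close>

definition Omega :: "real set" where
  "Omega = {0..1} - \<rat>"

definition D_set :: "real set" where
  "D_set = (\<Union>n\<in>{n::nat. odd n}. {1 / (real n + 1) ..< 1 / real n})"

definition e_D :: "real \<Rightarrow> int" where
  "e_D x = (if x \<in> D_set then - 1 else 1)"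

definition a_D :: "real \<Rightarrow> int" where
  "a_D x = (if x \<in> D_set then 1 + \<lfloor>1 / x\<rfloor> else \<lfloor>1 / x\<rfloor>)"

definition T_D :: "real \<Rightarrow> real" where
  "T_D x = (if x \<in> D_set then 1 - frac (1 / x) else frac (1 / x))"

definition ecf_t :: "real \<Rightarrow> nat \<Rightarrow> real" where
  "ecf_t x n = (T_D ^^ n) x"

fun ecf_e :: "real \<Rightarrow> nat \<Rightarrow> int" where
  "ecf_e x 0 = 1"
| "ecf_e x (Suc n) = e_D (ecf_t x n)"

text \<open>Only \<open>n \<ge> 1\<close> is meaningful; the value at \<open>0\<close> is junk and is never used.\<close>

definition ecf_a :: "real \<Rightarrow> nat \<Rightarrow> int" where
  "ecf_a x n = a_D (ecf_t x (n - 1))"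

text \<open>
  Numerators and denominators of the convergents. The case distinction supplies the
  initial values at index \<open>-1\<close>, which are \<open>1\<close> for \<open>p\<close> and \<open>0\<close> for \<open>q\<close>.
\<close>

fun ecf_p :: "real \<Rightarrow> nat \<Rightarrow> int" where
  "ecf_p x 0 = 0"
| "ecf_p x (Suc n) =
     ecf_a x (Suc n) * ecf_p x n + ecf_e x n * (case n of 0 \<Rightarrow> 1 | Suc m \<Rightarrow> ecf_p x m)"

fun ecf_q :: "real \<Rightarrow> nat \<Rightarrow> int" where
  "ecf_q x 0 = 1"
| "ecf_q x (Suc n) =
     ecf_a x (Suc n) * ecf_q x n + ecf_e x n * (case n of 0 \<Rightarrow> 0 | Suc m \<Rightarrow> ecf_q x m)"

text \<open>
  The convergents are compared as pairs (numerator, denominator), not as rational numbers.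
\<close>

definition successive_convergents :: "real \<Rightarrow> int \<Rightarrow> int \<Rightarrow> int \<Rightarrow> int \<Rightarrow> bool" where
  "successive_convergents x P Q P' Q' \<longleftrightarrow>
     (\<exists>n\<ge>1. P = ecf_p x (n - 1) \<and> Q = ecf_q x (n - 1) \<and> P' = ecf_p x n \<and> Q' = ecf_q x n)"


section \<open>The set of matrices\<close>

definition mat2 :: "'a::zero \<Rightarrow> 'a \<Rightarrow> 'a \<Rightarrow> 'a \<Rightarrow> 'a^2^2" where
  "mat2 a b c d = vector [vector [a, b], vector [c, d]]"

definition mat_cong2 :: "int^2^2 \<Rightarrow> int^2^2 \<Rightarrow> bool" where
  "mat_cong2 A B \<longleftrightarrow> (\<forall>i j. [A $ i $ j = B $ i $ j] (mod 2))"

text \<open>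
  \<^const>\<open>invertible\<close> at type \<^typ>\<open>int^2^2\<close> asks for a two-sided inverse with integer entries,
  so it is membership in the general linear group over the integers.
\<close>

definition R_E :: "(int^2^2) set" where
  "R_E = {mat2 P P' Q Q' | P P' Q Q'.
            invertible (mat2 P P' Q Q') \<and>
            0 \<le> P \<and> P \<le> Q \<and> 1 \<le> P' \<and> P' \<le> Q' \<and> 1 \<le> Q \<and> Q \<le> Q' \<and>
            (mat_cong2 (mat2 P P' Q Q') (mat2 1 0 0 1) \<or>
             mat_cong2 (mat2 P P' Q Q') (mat2 0 1 1 0))}"

definition E_map :: "int^2^2 \<Rightarrow> real \<Rightarrow> real" where
  "E_map M x = (of_int (M $ 2 $ 2) * x - of_int (M $ 1 $ 2)) /
               (- of_int (M $ 2 $ 1) * x + of_int (M $ 1 $ 1))"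

end

theory Submission
  imports Defs
begin

text \<open>
  For every \<open>n \<ge> 1\<close> the matrix \<open>M\<^sub>n\<close> with columns \<open>(p\<^sub>n\<^sub>-\<^sub>1, q\<^sub>n\<^sub>-\<^sub>1)\<close> and \<open>(p\<^sub>n, q\<^sub>n)\<close> acts by
  \<open>x = (p\<^sub>n\<^sub>-\<^sub>1 y + p\<^sub>n) / (q\<^sub>n\<^sub>-\<^sub>1 y + q\<^sub>n)\<close> with \<open>y = e\<^sub>n t\<^sub>n\<close>, and \<open>E_map M\<^sub>n x\<close> is this \<open>y\<close>, a number
  with \<open>0 < \<bar>y\<bar> < 1\<close>. Membership of \<open>M\<^sub>n\<close> in \<open>R_E\<close> follows by induction from
  \<open>M\<^sub>n\<^sub>+\<^sub>1 = M\<^sub>n (0, e\<^sub>n; 1, a\<^sub>n\<^sub>+\<^sub>1)\<close>: as \<open>a\<^sub>n\<^sub>+\<^sub>1\<close> is even and \<open>e\<^sub>n = \<plusminus>1\<close>, the last factor is \<open>J\<close>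
  modulo 2, and \<open>a\<^sub>n\<^sub>+\<^sub>1 \<ge> 2\<close> makes \<open>p\<^sub>n\<close>, \<open>q\<^sub>n\<close> and \<open>q\<^sub>n - p\<^sub>n\<close> nondecreasing.

  The converse is a descent. If \<open>P = 0\<close>, the determinant forces \<open>P' = Q = 1\<close>, so \<open>Q'\<close> is an even
  integer at distance less than 1 from \<open>1/x\<close>; the only such integer is \<open>a\<^sub>1\<close>
  (\<open>even_quotient_unique\<close>). If \<open>P > 0\<close>, division of \<open>Q'\<close> by \<open>Q\<close> with even quotient \<open>a\<close> and signed
  remainder writes the matrix as \<open>M'' (0, e; 1, a)\<close> with \<open>M''\<close> again in \<open>R_E\<close> and with a smaller
  lower right entry (\<open>even_reduced_descent\<close>), and \<open>E_map M'' x = e / (a + y)\<close>. By induction \<open>M'' = M\<^sub>n\<close> and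
  \<open>e\<^sub>n t\<^sub>n = e / (a + y)\<close>; comparing signs gives \<open>e = e\<^sub>n\<close> and \<open>1/t\<^sub>n = a + y\<close>, hence \<open>a = a\<^sub>n\<^sub>+\<^sub>1\<close> by
  the same uniqueness.
\<close>

section \<open>The map \<open>T_D\<close>\<close>

lemma OmegaD:
  assumes "x \<in> Omega"
  shows "0 < x" "x < 1" "x \<notin> \<rat>"
proof -
  show irr: "x \<notin> \<rat>" using assms by (simp add: Omega_def)
  have "x \<noteq> 0" "x \<noteq> 1" using irr by auto
  then show "0 < x" "x < 1" using assms by (auto simp: Omega_def)
qed

lemma irrational_inverse: "(x::real) \<notin> \<rat> \<Longrightarrow> 1 / x \<notin> \<rat>"
  using Rats_divide[of 1 "1 / x"] by auto

lemma D_set_iff_odd_floor: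
  assumes "x \<in> Omega"
  shows "x \<in> D_set \<longleftrightarrow> odd \<lfloor>1 / x\<rfloor>"
proof
  assume "x \<in> D_set"
  then obtain n :: nat where n: "odd n" "1 / (real n + 1) \<le> x" "x < 1 / real n"
    by (auto simp: D_set_def)
  have "n > 0" using n(1) by (simp add: odd_pos)
  have "1 / x \<le> real n + 1" "real n < 1 / x"
    using n OmegaD(1)[OF assms] \<open>n > 0\<close> by (auto simp: field_simps)
  \<comment> \<open>The left end point of the interval is rational.\<close>
  moreover have "1 / x \<noteq> real n + 1"
    using irrational_inverse[OF OmegaD(3)[OF assms]]
    by (metis Rats_1 Rats_add Rats_of_nat)
  ultimately have "\<lfloor>1 / x\<rfloor> = int n" by (intro floor_unique) auto
  then show "odd \<lfloor>1 / x\<rfloor>" using n(1) by simp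
next
  assume odd: "odd \<lfloor>1 / x\<rfloor>"
  have pos: "0 < x" and "1 \<le> 1 / x" using OmegaD[OF assms] by (auto simp: field_simps)
  then have fl: "1 \<le> \<lfloor>1 / x\<rfloor>" by linarith
  define n where "n = nat \<lfloor>1 / x\<rfloor>"
  have int_n: "int n = \<lfloor>1 / x\<rfloor>" using fl unfolding n_def by linarith
  then have "odd (int n)" using odd by simp
  then have n: "odd n" "real n = of_int \<lfloor>1 / x\<rfloor>" "n > 0"
    by (simp_all add: int_n[symmetric] odd_pos)
  have "real n \<noteq> 1 / x"
    using irrational_inverse[OF OmegaD(3)[OF assms]] by (metis Rats_of_nat)
  then have "real n < 1 / x" "1 / x \<le> real n + 1"
    using n(2) of_int_floor_le[of "1 / x"] floor_correct[of "1 / x"] by linarith+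
  then have "x \<in> {1 / (real n + 1) ..< 1 / real n}"
    using pos n(3) by (auto simp: field_simps)
  then show "x \<in> D_set" using n(1) unfolding D_set_def by blast
qed

lemma T_D_in_Omega:
  assumes "x \<in> Omega"
  shows "T_D x \<in> Omega"
proof -
  have irr: "frac (1 / x) \<notin> \<rat>"
    using irrational_inverse[OF OmegaD(3)[OF assms]] Rats_add[of "frac (1 / x)" "of_int \<lfloor>1 / x\<rfloor>"]
    by (auto simp: frac_def)
  then have "1 - frac (1 / x) \<notin> \<rat>"
    using Rats_diff[of 1 "1 - frac (1 / x)"] by auto
  with irr show ?thesis
    using frac_lt_1[of "1 / x"] frac_ge_0[of "1 / x"] by (auto simp: T_D_def Omega_def)
qed

lemma inverse_eq_digit: "1 / x = of_int (a_D x) + of_int (e_D x) * T_D x"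
  by (auto simp: a_D_def e_D_def T_D_def frac_def)

lemma e_D_cases: "e_D x = 1 \<or> e_D x = -1"
  by (simp add: e_D_def)

lemma even_a_D: "x \<in> Omega \<Longrightarrow> even (a_D x)"
  by (auto simp: a_D_def D_set_iff_odd_floor)

lemma a_D_ge_2:
  assumes "x \<in> Omega"
  shows "2 \<le> a_D x"
proof -
  have "1 \<le> 1 / x" using OmegaD[OF assms] by (auto simp: field_simps)
  then have "1 \<le> \<lfloor>1 / x\<rfloor>" by linarith
  then have "1 \<le> a_D x" using OmegaD(1)[OF assms] by (simp add: a_D_def)
  moreover have "a_D x \<noteq> 1" using even_a_D[OF assms] by auto
  ultimately show ?thesis by linarith
qed

text \<open>
  The partial quotient \<open>a_D t\<close> is the only even integer at distance less than 1 from \<open>1/t\<close>.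
\<close>

lemma even_quotient_unique:
  assumes "t \<in> Omega" "even a" "\<bar>1 / t - of_int a\<bar> < 1"
  shows "a = a_D t"
proof -
  have "\<bar>1 / t - of_int (a_D t)\<bar> < 1"
    using OmegaD[OF T_D_in_Omega[OF assms(1)]] inverse_eq_digit[of t] e_D_cases[of t] by auto
  then have "\<bar>real_of_int (a - a_D t)\<bar> < 2" using assms(3) unfolding of_int_diff by linarith
  then have "\<bar>a - a_D t\<bar> < 2" by linarith
  moreover have "even (a - a_D t)" using even_a_D[OF assms(1)] assms(2) by simp
  ultimately have "a - a_D t = 0" by presburger
  then show ?thesis by simp
qed

section \<open>Matrices of consecutive convergents\<close>

lemma ecf_t_Suc: "ecf_t x (Suc n) = T_D (ecf_t x n)"
  by (simp add: ecf_t_def)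

lemma ecf_t_in_Omega: "x \<in> Omega \<Longrightarrow> ecf_t x n \<in> Omega"
  by (induction n) (auto simp: ecf_t_Suc T_D_in_Omega, simp add: ecf_t_def)

lemma ecf_a_Suc: "ecf_a x (Suc n) = a_D (ecf_t x n)"
  by (simp add: ecf_a_def)

text \<open>
  Membership of the matrix with rows \<open>(P, P')\<close> and \<open>(Q, Q')\<close> in \<^const>\<open>R_E\<close>, in terms of its
  entries; see \<open>mat2_in_R_E_iff\<close>.
\<close>

definition even_reduced :: "int \<Rightarrow> int \<Rightarrow> int \<Rightarrow> int \<Rightarrow> bool" where
  "even_reduced P P' Q Q' \<longleftrightarrow>
     (P * Q' - P' * Q = 1 \<or> P * Q' - P' * Q = -1) \<and>
     0 \<le> P \<and> P \<le> Q \<and> 1 \<le> P' \<and> P' \<le> Q' \<and> 1 \<le> Q \<and> Q \<le> Q' \<and>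
     (odd P \<and> even P' \<and> even Q \<and> odd Q' \<or> even P \<and> odd P' \<and> odd Q \<and> even Q')"

text \<open>
  The three inequalities after \<^const>\<open>even_reduced\<close>, in hypotheses and conclusion, carry the
  induction when \<open>e = -1\<close>: they say that \<open>p\<^sub>n\<close> and \<open>q\<^sub>n - p\<^sub>n\<close> do not decrease and that
  \<open>p\<^sub>n < q\<^sub>n\<close>.
\<close>

lemma even_reduced_step:
  assumes red: "even_reduced P P' Q Q'" and mono: "P \<le> P'" "Q - P \<le> Q' - P'" "P' < Q'"
    and a: "even a" "2 \<le> a" and e: "e = 1 \<or> e = -1"
  shows "even_reduced P' (a * P' + e * P) Q' (a * Q' + e * Q)"
    "P' \<le> a * P' + e * P" "Q' - P' \<le> (a * Q' + e * Q) - (a * P' + e * P)"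
    "a * P' + e * P < a * Q' + e * Q"
proof -
  note r = red[unfolded even_reduced_def]
  have P': "2 * P' \<le> a * P'" using a r by (intro mult_right_mono) auto
  have QP: "2 * (Q' - P') \<le> a * (Q' - P')" using a mono by (intro mult_right_mono) auto
  have "- P \<le> e * P" using e r by auto
  then have m1: "P' \<le> a * P' + e * P" using P' mono by linarith
  have m2: "Q' - P' \<le> (a * Q' + e * Q) - (a * P' + e * P)"
  proof -
    have eQP: "- (Q - P) \<le> e * (Q - P)" using e r by auto
    have "Q' - P' \<le> 2 * (Q' - P') + - (Q - P)" using mono(2) by simp
    also have "\<dots> \<le> a * (Q' - P') + e * (Q - P)" by (rule add_mono[OF QP eQP])
    finally show ?thesis by (simp add: algebra_simps)
  qed
  have m3: "a * P' + e * P < a * Q' + e * Q" using m2 mono by linarith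
  have det: "P' * (a * Q' + e * Q) - (a * P' + e * P) * Q' = - e * (P * Q' - P' * Q)"
    by (simp add: algebra_simps)
  have "even_reduced P' (a * P' + e * P) Q' (a * Q' + e * Q)"
    unfolding even_reduced_def det using r m1 m2 m3 e a mono by auto
  with m1 m2 m3 show "even_reduced P' (a * P' + e * P) Q' (a * Q' + e * Q)"
    "P' \<le> a * P' + e * P" "Q' - P' \<le> (a * Q' + e * Q) - (a * P' + e * P)"
    "a * P' + e * P < a * Q' + e * Q" by auto
qed

lemma convergents_even_reduced:
  assumes "x \<in> Omega"
  shows "even_reduced (ecf_p x n) (ecf_p x (Suc n)) (ecf_q x n) (ecf_q x (Suc n)) \<and>
    ecf_p x n \<le> ecf_p x (Suc n) \<and>
    ecf_q x n - ecf_p x n \<le> ecf_q x (Suc n) - ecf_p x (Suc n) \<and>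
    ecf_p x (Suc n) < ecf_q x (Suc n)"
proof (induction n)
  case 0
  have "even (ecf_a x 1)" "2 \<le> ecf_a x 1"
    using even_a_D[OF ecf_t_in_Omega[OF assms, of 0]] a_D_ge_2[OF ecf_t_in_Omega[OF assms, of 0]]
    by (simp_all add: ecf_a_def)
  then show ?case by (simp add: even_reduced_def)
next
  case (Suc n)
  have a: "even (ecf_a x (Suc (Suc n)))" "2 \<le> ecf_a x (Suc (Suc n))"
    using even_a_D a_D_ge_2 ecf_t_in_Omega[OF assms] by (simp_all add: ecf_a_Suc)
  have e: "ecf_e x (Suc n) = 1 \<or> ecf_e x (Suc n) = -1" by (simp add: e_D_cases)
  have p: "ecf_p x (Suc (Suc n)) =
      ecf_a x (Suc (Suc n)) * ecf_p x (Suc n) + ecf_e x (Suc n) * ecf_p x n"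
    and q: "ecf_q x (Suc (Suc n)) =
      ecf_a x (Suc (Suc n)) * ecf_q x (Suc n) + ecf_e x (Suc n) * ecf_q x n"
    by simp_all
  from Suc.IH even_reduced_step[OF _ _ _ _ a e] show ?case unfolding p q by blast
qed

text \<open>
  The identity \<open>x = (p\<^sub>n y + p\<^sub>n\<^sub>+\<^sub>1) / (q\<^sub>n y + q\<^sub>n\<^sub>+\<^sub>1)\<close> for \<open>y = e\<^sub>n\<^sub>+\<^sub>1 t\<^sub>n\<^sub>+\<^sub>1\<close>, with the denominator
  cleared.
\<close>

lemma convergents_moebius:
  assumes "x \<in> Omega"
  defines "y \<equiv> \<lambda>n. of_int (ecf_e x n) * ecf_t x n"
  shows "x * (of_int (ecf_q x n) * y (Suc n) + of_int (ecf_q x (Suc n))) =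
    of_int (ecf_p x n) * y (Suc n) + of_int (ecf_p x (Suc n))"
proof (induction n)
  case 0
  have "1 / x = of_int (a_D x) + y 1"
    using inverse_eq_digit[of x] by (simp add: y_def ecf_t_def)
  then show ?case using OmegaD[OF assms(1)]
    by (simp add: ecf_a_def ecf_t_def field_simps)
next
  case (Suc n)
  let ?t = "ecf_t x (Suc n)" and ?e = "real_of_int (ecf_e x (Suc n))"
  let ?a = "real_of_int (ecf_a x (Suc (Suc n)))"
  have pos: "?t > 0" using OmegaD ecf_t_in_Omega assms by blast
  have "1 / ?t = ?a + y (Suc (Suc n))"
    using inverse_eq_digit[of ?t] by (simp add: y_def ecf_t_Suc ecf_a_Suc)
  then have inv: "?t * (?a + y (Suc (Suc n))) = 1" using pos by (simp add: field_simps)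
  have p: "real_of_int (ecf_p x (Suc (Suc n))) = ?a * ecf_p x (Suc n) + ?e * ecf_p x n"
    and q: "real_of_int (ecf_q x (Suc (Suc n))) = ?a * ecf_q x (Suc n) + ?e * ecf_q x n"
    by simp_all
  define z where "z = y (Suc (Suc n))"
  have IH: "x * (ecf_q x n * (?e * ?t) + ecf_q x (Suc n)) =
      ecf_p x n * (?e * ?t) + ecf_p x (Suc n)"
    using Suc.IH by (simp only: y_def)
  have inv: "?t * (?a + z) = 1" using inv by (simp only: z_def)
  \<comment> \<open>Multiplying the induction hypothesis by \<open>a + z = 1/t\<close> gives the claim.\<close>
  show ?case unfolding p q z_def[symmetric] using IH inv by algebra
qed

section \<open>Descent in \<open>R_E\<close>\<close>

lemma nearest_even_multiple:
  fixes Q Q' :: int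
  assumes "1 \<le> Q"
  obtains a where "even a" "\<bar>Q' - a * Q\<bar> \<le> Q"
proof -
  define k where "k = (Q' + Q) div (2 * Q)"
  have "Q' + Q = k * (2 * Q) + (Q' + Q) mod (2 * Q)"
    unfolding k_def by (rule div_mult_mod_eq[symmetric])
  moreover have "0 \<le> (Q' + Q) mod (2 * Q)" "(Q' + Q) mod (2 * Q) < 2 * Q" using assms by auto
  ultimately have "\<bar>Q' - (2 * k) * Q\<bar> \<le> Q" by (auto simp: algebra_simps)
  then show ?thesis using that[of "2 * k"] by simp
qed

text \<open>
  One division step. Choosing the even multiple \<open>a Q\<close> nearest to \<open>Q'\<close> gives \<open>0 < Q0 \<le> Q\<close>; the
  bounds \<open>0 \<le> P0 \<le> Q0\<close> then follow from \<open>P0 Q - P Q0 = \<plusminus>1\<close> and \<open>0 < P < Q\<close>.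
\<close>

lemma even_reduced_descent:
  assumes red: "even_reduced P P' Q Q'" and P: "P \<noteq> 0"
  obtains a e P0 Q0 where "even a" "2 \<le> a" "e = 1 \<or> e = -1"
    "P' = a * P + e * P0" "Q' = a * Q + e * Q0" "even_reduced P0 P Q0 Q" "Q < Q'"
proof -
  note r = red[unfolded even_reduced_def]
  have P1: "1 \<le> P" using r P by simp
  have cop: "coprime P Q" "coprime Q Q'"
  proof -
    have "d dvd P * Q' - P' * Q \<Longrightarrow> is_unit d" for d
      using r by auto
    then show "coprime P Q" "coprime Q Q'"
      by (auto intro!: coprimeI)
  qed
  have PQ: "P < Q" "2 \<le> Q"
  proof -
    have "P \<noteq> Q" using r by auto
    then show "P < Q" using r by linarith
    then show "2 \<le> Q" using P1 by linarith
  qed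
  have ndvd: "\<not> Q dvd Q'"
    using cop(2) PQ(2) coprime_absorb_left[of Q Q'] by auto
  obtain a where a: "even a" "\<bar>Q' - a * Q\<bar> \<le> Q"
    using nearest_even_multiple[of Q Q'] PQ by auto
  define e :: int where "e = (if Q' - a * Q \<ge> 0 then 1 else -1)"
  define Q0 where "Q0 = e * (Q' - a * Q)"
  define P0 where "P0 = e * (P' - a * P)"
  have e: "e = 1 \<or> e = -1" by (simp add: e_def)
  have eqs: "P' = a * P + e * P0" "Q' = a * Q + e * Q0"
    using e by (auto simp: P0_def Q0_def)
  have Q0: "0 \<le> Q0" "Q0 \<le> Q" using a(2) by (auto simp: Q0_def e_def)
  have "Q0 \<noteq> 0" using ndvd eqs(2) by auto
  then have Q0_pos: "1 \<le> Q0" using Q0 by linarith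
  have "Q \<noteq> Q'" using ndvd by auto
  then have QQ': "Q < Q'" using r by linarith
  have a2: "2 \<le> a"
  proof (rule ccontr)
    assume "\<not> 2 \<le> a"
    with a(1) have "a \<le> 0" by (cases "a = 1") auto
    then have "a * Q \<le> 0" using PQ(2) by (simp add: mult_nonpos_nonneg)
    with a(2) QQ' show False by linarith
  qed
  have det: "P0 * Q - P * Q0 = - e * (P * Q' - P' * Q)"
    by (simp add: P0_def Q0_def algebra_simps)
  then have det': "P0 * Q - P * Q0 = 1 \<or> P0 * Q - P * Q0 = -1" using r e by auto
  have P0_nonneg: "0 \<le> P0"
  proof (rule ccontr)
    assume "\<not> 0 \<le> P0"
    then have "P0 * Q \<le> - 1 * Q" using PQ by (intro mult_right_mono) auto
    moreover have "0 \<le> P * Q0" using P1 Q0 by simp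
    ultimately show False using det' PQ by linarith
  qed
  \<comment> \<open>Otherwise the determinant would be at least \<open>Q + Q0 > 1\<close>.\<close>
  have P0_le: "P0 \<le> Q0"
  proof (rule ccontr)
    assume "\<not> P0 \<le> Q0"
    then have "(Q0 + 1) * Q \<le> P0 * Q" using PQ by (intro mult_right_mono) auto
    moreover have "P * Q0 \<le> (Q - 1) * Q0" using PQ Q0 by (intro mult_right_mono) auto
    ultimately have "Q + Q0 \<le> P0 * Q - P * Q0" by (simp add: algebra_simps)
    then show False using det' PQ Q0 by linarith
  qed
  have par: "odd P0 \<longleftrightarrow> odd P'" "odd Q0 \<longleftrightarrow> odd Q'" using e a(1) by (auto simp: P0_def Q0_def)
  have "even_reduced P0 P Q0 Q"
    unfolding even_reduced_def using det' P0_nonneg P0_le P1 PQ Q0 Q0_pos par r by auto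
  from that[OF a(1) a2 e eqs this QQ'] show thesis .
qed

text \<open>
  The value of \<open>y\<close> belongs to the conclusion because the inductive step reads off the next partial
  quotient from it.
\<close>

lemma even_reduced_imp_convergents:
  assumes "x \<in> Omega" "even_reduced P P' Q Q'"
    and "x * (of_int Q * y + of_int Q') = of_int P * y + of_int P'" "0 < \<bar>y\<bar>" "\<bar>y\<bar> < 1"
  shows "\<exists>n. P = ecf_p x n \<and> P' = ecf_p x (Suc n) \<and> Q = ecf_q x n \<and> Q' = ecf_q x (Suc n) \<and>
    y = of_int (ecf_e x (Suc n)) * ecf_t x (Suc n)"
  using assms(2-)
proof (induction "nat Q'" arbitrary: P P' Q Q' y rule: less_induct)
  case less
  note r = less.prems(1)[unfolded even_reduced_def]
  show ?case
  proof (cases "P = 0")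
    case True
    with r have "P' * Q = 1 \<or> P' * Q = -1" by auto
    moreover have "0 < P' * Q" using r by simp
    ultimately have "P' * Q = 1" by linarith
    then have one: "P' = 1" "Q = 1" using r by (auto simp: zmult_eq_1_iff)
    have y: "y = 1 / x - of_int Q'"
      using less.prems(2) OmegaD[OF assms(1)] True one by (simp add: field_simps)
    have Q': "Q' = a_D x"
      by (rule even_quotient_unique) (use assms(1) r True less.prems y in auto)
    show ?thesis
      using True one Q' y inverse_eq_digit[of x]
      by (intro exI[of _ 0]) (simp add: ecf_a_def ecf_t_def)
  next
    case False
    obtain a e P0 Q0 where a: "even a" "2 \<le> a" and e: "e = 1 \<or> e = -1"
      and eqs: "P' = a * P + e * P0" "Q' = a * Q + e * Q0"
      and red0: "even_reduced P0 P Q0 Q" and lt: "Q < Q'"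
      using even_reduced_descent[OF less.prems(1) False] by metis
    define w where "w = of_int a + y"
    have w: "1 < w" using a(2) less.prems(4) by (auto simp: w_def)
    have x_eq: "x * (of_int Q0 * (of_int e / w) + of_int Q) = of_int P0 * (of_int e / w) + of_int P"
    proof -
      have "x * (of_int Q0 * of_int e + of_int Q * w) = of_int P0 * of_int e + of_int P * w"
        using less.prems(2) unfolding w_def eqs of_int_add of_int_mult
        by (simp add: algebra_simps)
      then show ?thesis using w by (simp add: field_simps)
    qed
    have bd: "0 < \<bar>of_int e / w\<bar>" "\<bar>of_int e / w\<bar> < 1"
      using e w by (auto simp: field_simps)
    have "nat Q < nat Q'" using lt r by simp
    from less.hyps[OF this red0 x_eq bd] obtain n where
      n: "P0 = ecf_p x n" "P = ecf_p x (Suc n)" "Q0 = ecf_q x n" "Q = ecf_q x (Suc n)"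
      and ew: "of_int e / w = of_int (ecf_e x (Suc n)) * ecf_t x (Suc n)" by blast
    let ?t = "ecf_t x (Suc n)"
    have tO: "?t \<in> Omega" using ecf_t_in_Omega assms(1) .
    have t: "0 < ?t" using OmegaD tO by blast
    have sgn: "ecf_e x (Suc n) = 1 \<or> ecf_e x (Suc n) = -1" by (simp add: e_D_cases)
    have w1: "0 < 1 / w" using w by simp
    \<comment> \<open>Both \<open>1 / w\<close> and \<open>t\<^sub>n\<^sub>+\<^sub>1\<close> are positive, so signs and absolute values agree separately.\<close>
    have e_eq: "e = ecf_e x (Suc n)" and tw: "1 / w = ?t"
      using e sgn ew t w1 by (auto simp del: ecf_e.simps zero_less_divide_1_iff)
    have inv: "1 / ?t = of_int a + y" using w by (simp add: tw[symmetric] w_def)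
    have a_eq: "a = a_D ?t"
      by (rule even_quotient_unique[OF tO a(1)]) (use inv less.prems(4) in simp)
    have "y = of_int (e_D ?t) * T_D ?t"
      using inverse_eq_digit[of ?t] inv a_eq by simp
    then show ?thesis
      using eqs n e_eq a_eq
      by (intro exI[of _ "Suc n"]) (simp add: ecf_t_Suc ecf_a_Suc)
  qed
qed

section \<open>Matrices in \<open>R_E\<close> by their entries\<close>

lemma mat2_nth [simp]:
  "mat2 a b c d $ 1 $ 1 = a" "mat2 a b c d $ 1 $ 2 = b"
  "mat2 a b c d $ 2 $ 1 = c" "mat2 a b c d $ 2 $ 2 = d"
  by (simp_all add: mat2_def)

lemma invertible_mat2_iff:
  fixes P P' Q Q' :: int
  shows "invertible (mat2 P P' Q Q') \<longleftrightarrow> P * Q' - P' * Q = 1 \<or> P * Q' - P' * Q = -1"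
proof
  assume "invertible (mat2 P P' Q Q')"
  then obtain B where "mat2 P P' Q Q' ** B = mat 1" by (auto simp: invertible_def)
  then have "det (mat2 P P' Q Q') * det B = 1" by (metis det_I det_mul)
  then show "P * Q' - P' * Q = 1 \<or> P * Q' - P' * Q = -1"
    by (auto simp: det_2 zmult_eq_1_iff)
next
  define d where "d = P * Q' - P' * Q"
  assume "P * Q' - P' * Q = 1 \<or> P * Q' - P' * Q = -1"
  then have "d * d = 1" by (auto simp: d_def)
  \<comment> \<open>As \<open>d\<close> is its own inverse, the inverse matrix is \<open>d\<close> times the adjugate.\<close>
  then have "mat2 P P' Q Q' ** mat2 (d * Q') (- d * P') (- d * Q) (d * P) = mat 1"
    "mat2 (d * Q') (- d * P') (- d * Q) (d * P) ** mat2 P P' Q Q' = mat 1"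
    by (auto simp: vec_eq_iff forall_2 matrix_matrix_mult_def sum_2 mat_def d_def algebra_simps)
  then show "invertible (mat2 P P' Q Q')" unfolding invertible_def by blast
qed

lemma mat2_in_R_E_iff: "mat2 P P' Q Q' \<in> R_E \<longleftrightarrow> even_reduced P P' Q Q'"
proof -
  have inj: "mat2 a b c d = mat2 a' b' c' d' \<longleftrightarrow> a = a' \<and> b = b' \<and> c = c' \<and> d = d'"
    for a b c d a' b' c' d' :: int
    by (metis mat2_nth)
  have c: "[a = 0] (mod 2) \<longleftrightarrow> even a" "[a = 1] (mod 2) \<longleftrightarrow> odd a" for a :: int
    by (auto simp: cong_def odd_iff_mod_2_eq_one)
  show ?thesis
    unfolding R_E_def even_reduced_def
    by (auto simp: inj invertible_mat2_iff mat_cong2_def forall_2 c)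
qed

lemma E_map_eq_iff:
  assumes "x \<notin> \<rat>" "Q \<noteq> 0"
  shows "E_map (mat2 P P' Q Q') x = y \<longleftrightarrow>
    x * (of_int Q * y + of_int Q') = of_int P * y + of_int P'"
proof -
  have "- of_int Q * x + of_int P \<noteq> 0"
  proof
    assume "- of_int Q * x + of_int P = 0"
    then have "x = of_int P / of_int Q" using assms(2) by (simp add: field_simps)
    then show False using assms(1) by simp
  qed
  then show ?thesis by (auto simp: E_map_def divide_eq_eq algebra_simps)
qed

section \<open>Characterisation of successive convergents\<close>

theorem proposition3p2:
  fixes P Q P' Q' :: int and M :: "int^2^2" and x :: real
  assumes "M = mat2 P P' Q Q'"
    and "x \<in> Omega"
  shows "successive_convergents x P Q P' Q' \<longleftrightarrow>
         M \<in> R_E \<and> 0 < \<bar>E_map M x\<bar> \<and> \<bar>E_map M x\<bar> < 1"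
proof
  assume "successive_convergents x P Q P' Q'"
  then obtain m where "m \<ge> 1" "P = ecf_p x (m - 1)" "Q = ecf_q x (m - 1)"
    "P' = ecf_p x m" "Q' = ecf_q x m"
    by (auto simp: successive_convergents_def)
  then obtain n where n: "P = ecf_p x n" "Q = ecf_q x n" "P' = ecf_p x (Suc n)" "Q' = ecf_q x (Suc n)"
    by (cases m) auto
  have red: "even_reduced P P' Q Q'" using convergents_even_reduced[OF assms(2)] n by blast
  then have "Q \<noteq> 0" by (auto simp: even_reduced_def)
  then have E: "E_map M x = of_int (ecf_e x (Suc n)) * ecf_t x (Suc n)"
    unfolding assms(1) E_map_eq_iff[OF OmegaD(3)[OF assms(2)] \<open>Q \<noteq> 0\<close>]
    using convergents_moebius[OF assms(2)] n by blast
  have "0 < ecf_t x (Suc n)" "ecf_t x (Suc n) < 1"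
    using OmegaD ecf_t_in_Omega[OF assms(2)] by blast+
  moreover have "\<bar>real_of_int (ecf_e x (Suc n))\<bar> = 1" using e_D_cases[of "ecf_t x n"] by auto
  ultimately have "0 < \<bar>E_map M x\<bar>" "\<bar>E_map M x\<bar> < 1" unfolding E abs_mult by auto
  then show "M \<in> R_E \<and> 0 < \<bar>E_map M x\<bar> \<and> \<bar>E_map M x\<bar> < 1"
    using red assms(1) by (simp add: mat2_in_R_E_iff)
next
  assume R: "M \<in> R_E \<and> 0 < \<bar>E_map M x\<bar> \<and> \<bar>E_map M x\<bar> < 1"
  then have red: "even_reduced P P' Q Q'" using assms(1) by (simp add: mat2_in_R_E_iff)
  then have "Q \<noteq> 0" by (auto simp: even_reduced_def)
  then have "x * (of_int Q * E_map M x + of_int Q') = of_int P * E_map M x + of_int P'"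
    using E_map_eq_iff[OF OmegaD(3)[OF assms(2)], of Q P P' Q' "E_map M x"] assms(1) by blast
  from even_reduced_imp_convergents[OF assms(2) red this] R obtain n where
    "P = ecf_p x n" "P' = ecf_p x (Suc n)" "Q = ecf_q x n" "Q' = ecf_q x (Suc n)" by blast
  then show "successive_convergents x P Q P' Q'"
    unfolding successive_convergents_def by (intro exI[of _ "Suc n"]) simp
qed

end
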